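(* Let $q \ge 4$ be a prime power and let $1\le d\le e$ be integers. Then $|B_j(1)| \geq |B_j(i)|$ for all integers $i,j$ with $1 \le i \le d$ and $0 \le j \le d$.
   Context: With Gaussian coefficients $\genfrac{[}{]}{0pt}{}{a}{m} = \prod_{h=0}^{m-1}\frac{q^{a-h}-1}{q^{m-h}-1}$ (and $0$ if $m<0$), for $0\le i,j\le d$, $$B_j(i) = \sum_{h=0}^j (-1)^{j-h} \, q^{eh+\binom{j-h}{2}} \genfrac{[}{]}{0pt}{}{d-h}{d-j} \genfrac{[}{]}{0pt}{}{d-i}{h}.$$ The numbers $B_j(i)$, $0\le i\le d$, are the eigenvalues of the distance-$j$ graph of the bilinear forms graph $H_q(d,e)$, whose vertices are the $d\times e$ matrices over $\mathbb{F}_q$, adjacent when their difference has rank 1. *)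

theory Defs
  imports Complex_Main "HOL-Number_Theory.Prime_Powers"
begin

definition gauss_coeff :: "real \<Rightarrow> int \<Rightarrow> int \<Rightarrow> real" where
  "gauss_coeff q a m =
     (if m < 0 then 0
      else (\<Prod>h = 0..m - 1. (q powi (a - h) - 1) / (q powi (m - h) - 1)))"

text \<open>
  \<open>bilinear_B q d e j i\<close> is the number $B_j(i)$ for the bilinear forms graph $H_q(d,e)$,
  intended for \<open>i \<le> d\<close> and \<open>j \<le> d\<close>. In the sum \<open>h \<le> j\<close>, so the natural number
  subtraction \<open>j - h\<close> does not truncate.
\<close>
definition bilinear_B :: "real \<Rightarrow> nat \<Rightarrow> nat \<Rightarrow> nat \<Rightarrow> nat \<Rightarrow> real" where
  "bilinear_B q d e j i =
     (\<Sum>h = 0..j. (-1) ^ (j - h) * q ^ (e * h + ((j - h) choose 2))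
        * gauss_coeff q (int d - int h) (int d - int j)
        * gauss_coeff q (int d - int i) (int h))"

end

(*
  In the sum for B_j(i) the absolute values of the terms grow with h by a factor of at least 9/4,
  up to the last nonzero one, at h = min j (d - i). As the signs alternate, |B_j(i)| is at most
  this last term and at least 5/9 of it. For i \<ge> 2 and j \<ge> 1 the last term for i is at most 4/9
  of the last term for 1: if the two indices h coincide (both are j), the Gaussian coefficient
  [d-i, j] is at most q^(-j) times [d-1, j]; otherwise replacing i by 1 does not decrease the term,
  and moving on to the last index gains the factor 9/4.
*)
theory Submission
  imports Defs
begin

section \<open>Gaussian coefficients with natural number arguments\<close>

text \<open>Truncated subtraction is harmless in the numerators: for \<open>n < m\<close> the factor
  at \<open>h = n\<close> is already 0. In the denominators \<open>m - h\<close> is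
  positive.\<close>

definition gaussian :: "real \<Rightarrow> nat \<Rightarrow> nat \<Rightarrow> real" where
  "gaussian q n m = (\<Prod>h<m. (q ^ (n - h) - 1) / (q ^ (m - h) - 1))"

lemma gaussian_eq_0: "n < m \<Longrightarrow> gaussian q n m = 0"
  unfolding gaussian_def by (intro prod_zero) (auto intro!: bexI[of _ n])

lemma gaussian_nonneg: "q > 1 \<Longrightarrow> gaussian q n m \<ge> 0"
  unfolding gaussian_def by (intro prod_nonneg) (simp add: one_le_power)

text \<open>For \<open>n < m\<close> both products contain the zero factor \<open>h = n\<close>,
  even though later exponents of \<open>gauss_coeff\<close> are negative. Otherwise no exponent is
  negative and the factors agree one by one.\<close>

lemma gauss_coeff_of_nat: "gauss_coeff q (int n) (int m) = gaussian q n m"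
proof -
  have *: "gauss_coeff q (int n) (int m) =
      (\<Prod>h<m. (q powi (int n - int h) - 1) / (q powi (int m - int h) - 1))"
  proof -
    have "(\<Prod>h = 0..int m - 1. (q powi (int n - h) - 1) / (q powi (int m - h) - 1)) =
        (\<Prod>h<m. (q powi (int n - int h) - 1) / (q powi (int m - int h) - 1))"
      by (rule prod.reindex_bij_witness[of _ int nat]) auto
    then show ?thesis unfolding gauss_coeff_def by simp
  qed
  show ?thesis
  proof (cases "n < m")
    case True
    then have "gauss_coeff q (int n) (int m) = 0"
      unfolding * by (intro prod_zero) (auto intro!: bexI[of _ n])
    then show ?thesis using True by (simp add: gaussian_eq_0)
  next
    case False
    show ?thesis unfolding * gaussian_def
    proof (rule prod.cong)
      fix h assume "h \<in> {..<m}"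
      then have "int n - int h = int (n - h)" "int m - int h = int (m - h)" using False by auto
      then show "(q powi (int n - int h) - 1) / (q powi (int m - int h) - 1) =
          (q ^ (n - h) - 1) / (q ^ (m - h) - 1)" by (simp only: power_int_of_nat)
    qed simp
  qed
qed

text \<open>The quotient of neighbours in the lower index, multiplied out so that it also covers
  \<open>n \<le> m\<close>, where both sides are 0.\<close>

lemma gaussian_Suc_right:
  assumes "q > 1"
  shows "gaussian q n (Suc m) * (q ^ Suc m - 1) = gaussian q n m * (q ^ (n - m) - 1)"
proof -
  have "q ^ Suc m \<noteq> 1" using one_less_power[OF assms, of "Suc m"] by simp
  moreover have "(\<Prod>h<Suc m. q ^ (Suc m - h) - 1) = (q ^ Suc m - 1) * (\<Prod>h<m. q ^ (m - h) - 1)"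
    by (subst prod.lessThan_Suc_shift) simp
  ultimately show ?thesis
    unfolding gaussian_def prod_dividef by (simp del: power_Suc)
qed

text \<open>The denominators agree and the numerators overlap except at their ends. With the extra
  factor, both become the product of \<open>q ^ (Suc n - h) - 1\<close> over
  \<open>h < Suc m\<close>.\<close>

lemma gaussian_Suc_left:
  "gaussian q (Suc n) m * (q ^ (Suc n - m) - 1) = gaussian q n m * (q ^ Suc n - 1)"
proof -
  have "(\<Prod>h<m. q ^ (Suc n - h) - 1) * (q ^ (Suc n - m) - 1) = (\<Prod>h<Suc m. q ^ (Suc n - h) - 1)"
    by simp
  also have "\<dots> = (q ^ Suc n - 1) * (\<Prod>h<m. q ^ (n - h) - 1)"
    by (subst prod.lessThan_Suc_shift) simp
  finally show ?thesis
    unfolding gaussian_def prod_dividef by (simp del: power_Suc)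
qed

text \<open>The quotient of the two coefficients is (q^(n+1) - 1) / (q^(n+1-m) - 1), and this is at
  least q^m because q^m \<ge> 1.\<close>

lemma gaussian_Suc_left_ge:
  assumes "q > 1"
  shows "q ^ m * gaussian q n m \<le> gaussian q (Suc n) m"
proof (cases "m \<le> n")
  case True
  have pos: "q ^ (Suc n - m) - 1 > 0"
    using one_less_power[OF assms, of "Suc n - m"] True by simp
  have "q ^ m * (q ^ (Suc n - m) - 1) = q ^ Suc n - q ^ m"
    using True by (simp add: right_diff_distrib flip: power_add)
  also have "\<dots> \<le> q ^ Suc n - 1" using assms by (simp add: one_le_power)
  finally have "gaussian q n m * (q ^ m * (q ^ (Suc n - m) - 1)) \<le> gaussian q n m * (q ^ Suc n - 1)"
    using gaussian_nonneg[OF assms] by (rule mult_left_mono)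
  then have "(q ^ m * gaussian q n m) * (q ^ (Suc n - m) - 1)
      \<le> gaussian q (Suc n) m * (q ^ (Suc n - m) - 1)"
    unfolding gaussian_Suc_left by (simp add: mult_ac)
  then show ?thesis using pos by simp
next
  case False
  then show ?thesis using gaussian_nonneg[OF assms] by (simp add: gaussian_eq_0)
qed

lemma gaussian_mono_left:
  assumes "q > 1" "n \<le> n'"
  shows "gaussian q n m \<le> gaussian q n' m"
proof (rule lift_Suc_mono_le[OF _ assms(2)])
  fix k
  have "gaussian q k m \<le> q ^ m * gaussian q k m"
    using assms(1) mult_right_mono[OF one_le_power gaussian_nonneg[OF assms(1)], of q k m m] by simp
  then show "gaussian q k m \<le> gaussian q (Suc k) m"
    using gaussian_Suc_left_ge[OF assms(1), of m k] by simp
qed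

text \<open>The step from \<open>n\<close> to \<open>Suc n\<close> supplies the factor
  \<open>q ^ m\<close>; monotonicity covers the rest.\<close>

lemma gaussian_less_left_ge:
  assumes "q > 1" "n < n'"
  shows "q ^ m * gaussian q n m \<le> gaussian q n' m"
  using gaussian_Suc_left_ge[OF assms(1), of m n] gaussian_mono_left[OF assms(1), of "Suc n" n' m]
    assms(2) by simp

section \<open>Alternating sums of geometrically growing terms\<close>

text \<open>If S is the sum up to m, the sum up to m + 1 is a(m+1) - S. Induction gives 0 \<le> S
  \<le> a(m) \<le> a(m+1) / c: the first inequality yields the new upper bound, the others the new
  lower bound.\<close>

lemma alternating_sum_bounds:
  fixes a :: "nat \<Rightarrow> real"
  assumes nonneg: "\<And>h. a h \<ge> 0"
    and growth: "\<And>h. h < m \<Longrightarrow> c * a h \<le> a (Suc h)"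
    and c: "c \<ge> 1"
  shows "(\<Sum>h\<le>m. (-1) ^ (m - h) * a h) \<le> a m"
    and "(c - 1) * a m \<le> c * (\<Sum>h\<le>m. (-1) ^ (m - h) * a h)"
proof -
  have "(\<Sum>h\<le>m. (-1) ^ (m - h) * a h) \<le> a m \<and>
      (c - 1) * a m \<le> c * (\<Sum>h\<le>m. (-1) ^ (m - h) * a h)"
    using growth
  proof (induction m)
    case 0
    then show ?case using nonneg[of 0] by (simp add: left_diff_distrib)
  next
    case (Suc m)
    define S where "S = (\<Sum>h\<le>m. (-1) ^ (m - h) * a h)"
    have "(\<Sum>h\<le>m. (-1) ^ (Suc m - h) * a h) = - S"
      unfolding S_def sum_negf[symmetric] by (rule sum.cong) (simp_all add: Suc_diff_le)
    then have step: "(\<Sum>h\<le>Suc m. (-1) ^ (Suc m - h) * a h) = a (Suc m) - S" by simp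
    have IH: "S \<le> a m" "(c - 1) * a m \<le> c * S" using Suc unfolding S_def by simp_all
    have "0 \<le> (c - 1) * a m" using c nonneg[of m] by simp
    then have "0 \<le> c * S" using IH(2) by linarith
    then have "0 \<le> S" using c by (simp add: zero_le_mult_iff)
    moreover have "c * S \<le> c * a m" using IH(1) c by simp
    then have "c * S \<le> a (Suc m)" using Suc.prems[of m] by linarith
    ultimately show ?case unfolding step by (simp add: algebra_simps)
  qed
  then show "(\<Sum>h\<le>m. (-1) ^ (m - h) * a h) \<le> a m"
    and "(c - 1) * a m \<le> c * (\<Sum>h\<le>m. (-1) ^ (m - h) * a h)" by auto
qed

section \<open>Growth of the terms of the sum\<close>

text \<open>The summand of B_j(i) without its sign. The parameter \<open>n\<close> stands for d - i,
  so that i can be varied while \<open>h\<close> stays fixed.\<close>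

definition B_term :: "real \<Rightarrow> nat \<Rightarrow> nat \<Rightarrow> nat \<Rightarrow> nat \<Rightarrow> nat \<Rightarrow> real" where
  "B_term q d e j n h =
     q ^ (e * h + ((j - h) choose 2)) * gaussian q (d - h) (d - j) * gaussian q n h"

lemma B_term_nonneg: "q > 1 \<Longrightarrow> B_term q d e j n h \<ge> 0"
  unfolding B_term_def by (simp add: gaussian_nonneg)

lemma B_term_mono:
  assumes "q > 1" "n \<le> n'"
  shows "B_term q d e j n h \<le> B_term q d e j n' h"
  unfolding B_term_def using assms gaussian_nonneg[OF assms(1)]
  by (intro mult_left_mono gaussian_mono_left) auto

text \<open>Source of the growth constant: two such estimates give 9/16, and one spare factor q
  \<ge> 4 raises this to 9/4.\<close>

lemma power_minus_one_ge:
  fixes q :: real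
  assumes "q \<ge> 4" "k > 0"
  shows "3/4 * q ^ k \<le> q ^ k - 1"
proof -
  have "4 \<le> q ^ k"
    using assms self_le_power[of q k] by simp
  then show ?thesis by simp
qed

text \<open>With a = j - h - 1 and b = n - h, the quotient of consecutive terms is q^(e-a) (q^(a+1)
  - 1) (q^b - 1) / ((q^(d-h) - 1) (q^(h+1) - 1)). This is at least 9/16 q^(e-d+b), hence at least
  9/4.\<close>

lemma B_term_growth:
  assumes q: "q \<ge> 4" and "j \<le> d" "d \<le> e" "h < j" "h < n"
  shows "9/4 * B_term q d e j n h \<le> B_term q d e j n (Suc h)"
proof -
  have q1: "q > 1" using q by simp
  define a b where "a = j - Suc h" and "b = n - h"
  define X where "X = q ^ (e * h + (a choose 2))"
  define g g' f f' where "g = gaussian q (d - h) (d - j)" and "g' = gaussian q (d - Suc h) (d - j)"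
    and "f = gaussian q n h" and "f' = gaussian q n (Suc h)"
  have jh: "j - h = Suc a" using assms a_def by simp
  have X: "X > 0" and nonneg: "g \<ge> 0" "f \<ge> 0"
    using q1 by (simp_all add: X_def g_def f_def gaussian_nonneg)
  \<comment> \<open>Pascal's rule, \<open>Suc a choose 2 = a + (a choose 2)\<close>, splits off the
    power \<open>q ^ a\<close>.\<close>
  have T: "B_term q d e j n h = X * q ^ a * g * f"
    unfolding B_term_def jh X_def g_def f_def by (simp add: numeral_2_eq_2 power_add)
  have T': "B_term q d e j n (Suc h) = X * q ^ e * g' * f'"
    unfolding B_term_def X_def a_def g'_def f'_def by (simp add: power_add)
  have "Suc (d - Suc h) = d - h" "Suc (d - Suc h) - (d - j) = Suc a"
    using assms jh by auto
  then have g: "g * (q ^ Suc a - 1) = g' * (q ^ (d - h) - 1)"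
    using gaussian_Suc_left[of q "d - Suc h" "d - j"] unfolding g_def g'_def by simp
  have f: "f' * (q ^ Suc h - 1) = f * (q ^ b - 1)"
    unfolding f_def f'_def b_def by (rule gaussian_Suc_right[OF q1])
  \<comment> \<open>The denominator of the quotient; the inequality is proved multiplied by
    it.\<close>
  define P where "P = (q ^ (d - h) - 1) * (q ^ Suc h - 1)"
  have pos: "q ^ (d - h) - 1 > 0" "q ^ Suc h - 1 > 0"
    using one_less_power[OF q1, of "d - h"] one_less_power[OF q1, of "Suc h"] assms by auto
  then have P: "P > 0" unfolding P_def by simp
  have "P \<le> q ^ (d - h) * q ^ Suc h"
    unfolding P_def using pos q1 by (intro mult_mono) auto
  also have "\<dots> = q ^ Suc d" using assms by (simp flip: power_add power_Suc)
  finally have "9/4 * (q ^ a * P) \<le> 9/4 * (q ^ a * q ^ Suc d)" using q1 by simp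
  also have "\<dots> = 9/16 * (q ^ a * q ^ Suc d * 4)" by simp
  also have "\<dots> \<le> 9/16 * (q ^ a * q ^ Suc d * q)"
    using q by (intro mult_left_mono) auto
  also have "\<dots> = 9/16 * q ^ (a + d + 2)" by (simp add: power_add power2_eq_square)
  \<comment> \<open>The exponents compare because d \<le> e and b \<ge> 1, the latter from
    \<open>h < n\<close>.\<close>
  also have "\<dots> \<le> 9/16 * q ^ (e + Suc a + b)"
    using assms q1 b_def by (intro mult_left_mono power_increasing) auto
  also have "\<dots> = q ^ e * ((3/4 * q ^ Suc a) * (3/4 * q ^ b))" by (simp add: power_add)
  also have "\<dots> \<le> q ^ e * ((q ^ Suc a - 1) * (q ^ b - 1))"
    using q assms b_def power_minus_one_ge[OF q, of "Suc a"] power_minus_one_ge[OF q, of b]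
    by (intro mult_left_mono mult_mono) (auto simp: one_le_power)
  finally have "(X * g * f) * (9/4 * (q ^ a * P))
      \<le> (X * g * f) * (q ^ e * ((q ^ Suc a - 1) * (q ^ b - 1)))"
    using X nonneg by (intro mult_left_mono) auto
  also have "\<dots> = X * q ^ e * (g * (q ^ Suc a - 1)) * (f * (q ^ b - 1))" by (simp only: mult_ac)
  also have "\<dots> = (X * q ^ e * g' * f') * P"
    unfolding g f[symmetric] P_def by (simp only: mult_ac)
  finally have "(9/4 * (X * q ^ a * g * f)) * P \<le> (X * q ^ e * g' * f') * P"
    by (simp only: mult_ac)
  then show ?thesis unfolding T T' using P by (rule mult_right_le_imp_le)
qed

lemma B_term_le_last:
  assumes "q \<ge> 4" "j \<le> d" "d \<le> e" "m \<le> j" "m \<le> n" "h < m"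
  shows "9/4 * B_term q d e j n h \<le> B_term q d e j n m"
  using assms(4-6)
proof (induction m)
  case (Suc m)
  have q1: "q > 1" using assms(1) by simp
  have step: "9/4 * B_term q d e j n m \<le> B_term q d e j n (Suc m)"
    using Suc.prems assms by (intro B_term_growth) auto
  show ?case
  proof (cases "h = m")
    case True
    then show ?thesis using step by simp
  next
    case False
    then have "9/4 * B_term q d e j n h \<le> B_term q d e j n m" using Suc by simp
    then show ?thesis using step B_term_nonneg[OF q1, of d e j n m] by linarith
  qed
qed simp

section \<open>Bounding the eigenvalue by its last nonzero term\<close>

text \<open>Beyond h = d - i the factor \<open>gaussian q (d - i) h\<close> vanishes, so the sum can
  be cut there. Counting signs from the new last index changes only a global sign, which the
  absolute value removes.\<close>

lemma bilinear_B_eq: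
  assumes "i \<le> d" "j \<le> d"
  shows "\<bar>bilinear_B q d e j i\<bar> =
     \<bar>\<Sum>h\<le>min j (d - i). (-1) ^ (min j (d - i) - h) * B_term q d e j (d - i) h\<bar>"
proof -
  let ?m = "min j (d - i)"
  have "bilinear_B q d e j i = (\<Sum>h = 0..j. (-1) ^ (j - h) * B_term q d e j (d - i) h)"
    unfolding bilinear_B_def
  proof (rule sum.cong)
    fix h assume "h \<in> {0..j}"
    then have "int d - int h = int (d - h)" "int d - int j = int (d - j)"
      "int d - int i = int (d - i)" using assms by auto
    then show "(-1) ^ (j - h) * q ^ (e * h + ((j - h) choose 2))
        * gauss_coeff q (int d - int h) (int d - int j) * gauss_coeff q (int d - int i) (int h)
        = (-1) ^ (j - h) * B_term q d e j (d - i) h"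
      by (simp only: gauss_coeff_of_nat B_term_def mult.assoc)
  qed simp
  also have "\<dots> = (\<Sum>h\<le>?m. (-1) ^ (j - h) * B_term q d e j (d - i) h)"
    by (rule sum.mono_neutral_right) (auto simp: B_term_def gaussian_eq_0)
  also have "\<dots> = (\<Sum>h\<le>?m. (-1) ^ (j - ?m) * ((-1) ^ (?m - h) * B_term q d e j (d - i) h))"
  proof (rule sum.cong)
    fix h assume "h \<in> {..?m}"
    then have "j - h = (j - ?m) + (?m - h)" by auto
    then show "(-1) ^ (j - h) * B_term q d e j (d - i) h =
        (-1) ^ (j - ?m) * ((-1) ^ (?m - h) * B_term q d e j (d - i) h)"
      by (simp only: power_add mult.assoc)
  qed simp
  finally show ?thesis by (simp add: abs_mult power_abs flip: sum_distrib_left)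
qed

text \<open>The alternating sum estimate with c = 9/4, where 1 - 1/c = 5/9. The lower bound also
  shows that the sum is nonnegative, so both bounds pass to the absolute value.\<close>

lemma bilinear_B_bounds:
  assumes "q \<ge> 4" "i \<le> d" "j \<le> d" "d \<le> e"
  shows "\<bar>bilinear_B q d e j i\<bar> \<le> B_term q d e j (d - i) (min j (d - i))"
    and "5/9 * B_term q d e j (d - i) (min j (d - i)) \<le> \<bar>bilinear_B q d e j i\<bar>"
proof -
  let ?m = "min j (d - i)"
  define S where "S = (\<Sum>h\<le>?m. (-1) ^ (?m - h) * B_term q d e j (d - i) h)"
  have nonneg: "B_term q d e j (d - i) h \<ge> 0" for h
    using assms(1) by (intro B_term_nonneg) simp
  have growth: "9/4 * B_term q d e j (d - i) h \<le> B_term q d e j (d - i) (Suc h)" if "h < ?m" for h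
    using that assms by (intro B_term_growth) auto
  have "S \<le> B_term q d e j (d - i) ?m"
    and lower: "5/4 * B_term q d e j (d - i) ?m \<le> 9/4 * S"
    using alternating_sum_bounds[of "B_term q d e j (d - i)" ?m "9/4", OF nonneg growth]
    by (simp_all add: S_def)
  moreover have "0 \<le> S" using lower nonneg[of ?m] by linarith
  moreover note lower
  ultimately show "\<bar>bilinear_B q d e j i\<bar> \<le> B_term q d e j (d - i) ?m"
    and "5/9 * B_term q d e j (d - i) ?m \<le> \<bar>bilinear_B q d e j i\<bar>"
    unfolding bilinear_B_eq[OF assms(2,3)] S_def[symmetric] by linarith+
qed

section \<open>Comparison of i with 1\<close>

lemma last_B_term_le:
  assumes q: "q \<ge> 4" and "d \<le> e" "2 \<le> i" "i \<le> d" "1 \<le> j" "j \<le> d"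
  shows "9/4 * B_term q d e j (d - i) (min j (d - i)) \<le> B_term q d e j (d - 1) (min j (d - 1))"
proof (cases "j \<le> d - i")
  case True
  have q1: "q > 1" using q by simp
  \<comment> \<open>Both last indices are j here, so only this Gaussian coefficient depends on i. As
    j \<ge> 1, q^j \<ge> q \<ge> 4 > 9/4.\<close>
  have "9/4 * gaussian q (d - i) j \<le> q ^ j * gaussian q (d - i) j"
    using q assms self_le_power[of q j] gaussian_nonneg[OF q1]
    by (intro mult_right_mono) auto
  also have "\<dots> \<le> gaussian q (d - 1) j"
    using assms by (intro gaussian_less_left_ge[OF q1]) auto
  finally have "q ^ (e * j) * gaussian q (d - j) (d - j) * (9/4 * gaussian q (d - i) j)
      \<le> q ^ (e * j) * gaussian q (d - j) (d - j) * gaussian q (d - 1) j"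
    using q1 gaussian_nonneg[OF q1] by (intro mult_left_mono) auto
  moreover have "min j (d - i) = j" "min j (d - 1) = j" using True assms by auto
  ultimately show ?thesis by (simp add: B_term_def mult_ac numeral_2_eq_2)
next
  case False
  have "9/4 * B_term q d e j (d - i) (d - i) \<le> 9/4 * B_term q d e j (d - 1) (d - i)"
    using q assms B_term_mono[of q "d - i" "d - 1"] by simp
  \<comment> \<open>The index really increases: d - i is below j by the case and below d - 1 because
    i \<ge> 2.\<close>
  also have "\<dots> \<le> B_term q d e j (d - 1) (min j (d - 1))"
    using q assms False by (intro B_term_le_last) auto
  finally show ?thesis using False by simp
qed

theorem theorem7p5:
  fixes q d e :: nat
  assumes "primepow q" and "q \<ge> 4" and "1 \<le> d" and "d \<le> e"
  shows "\<forall>i j. 1 \<le> i \<and> i \<le> d \<and> 0 \<le> j \<and> j \<le> d \<longrightarrow>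
           \<bar>bilinear_B (real q) d e j 1\<bar> \<ge> \<bar>bilinear_B (real q) d e j i\<bar>"
proof (intro allI impI)
  fix i j assume ij: "1 \<le> i \<and> i \<le> d \<and> 0 \<le> j \<and> j \<le> d"
  have q: "real q \<ge> 4" using assms(2) by simp
  consider "i = 1" | "j = 0" | "2 \<le> i" "1 \<le> j" using ij by linarith
  then show "\<bar>bilinear_B (real q) d e j 1\<bar> \<ge> \<bar>bilinear_B (real q) d e j i\<bar>"
  proof cases
    \<comment> \<open>For j = 0 only the term h = 0 remains, and it does not depend on i.\<close>
    case 2
    then show ?thesis
      using ij assms(3) by (simp add: bilinear_B_eq B_term_def gaussian_def)
  next
    case 3
    have "\<bar>bilinear_B (real q) d e j i\<bar> \<le> B_term q d e j (d - i) (min j (d - i))"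
      using ij assms q by (intro bilinear_B_bounds) auto
    also have "\<dots> \<le> 4/9 * B_term q d e j (d - 1) (min j (d - 1))"
      using last_B_term_le[OF q assms(4), of i j] ij 3 by simp
    also have "\<dots> \<le> 5/9 * B_term q d e j (d - 1) (min j (d - 1))"
      using B_term_nonneg[of q] q by simp
    also have "\<dots> \<le> \<bar>bilinear_B (real q) d e j 1\<bar>"
      using ij assms q by (intro bilinear_B_bounds) auto
    finally show ?thesis .
  qed simp
qed

end
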